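(* Let $\omega>0$. For every integer $n\ge1$ the following identity between polynomials in $z$ holds: $$\mathcal{S}_n^\omega(z)=z\,\mathcal{S}_{n-1}^\omega(z)+\frac{\omega^2}{(\omega+n-1)(\omega+n)}\,\mathcal{S}_{n-1}^{\omega-1}(z).$$
   Context: For $n\in\{0,1,2,\ldots\}$ and real $\omega\notin\{-1,\ldots,-n\}$ the skyburst polynomial $\mathcal{S}_n^\omega$ is the monic polynomial of degree $n$ $$\mathcal{S}_n^\omega(z)=z^n\,{}_2F_1\!\left[\begin{array}{l}-n,-\omega;\\-n-\omega;\end{array}-\frac1z\right]=\sum_{\ell=0}^n\binom{n}{\ell}\frac{(-\omega)_\ell}{(-n-\omega)_\ell}\,z^{n-\ell},$$ where $(a)_\ell=a(a+1)\cdots(a+\ell-1)$, $(a)_0=1$. *)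

theory Defs
  imports "HOL-Computational_Algebra.Polynomial"
begin

(* Intended for omega outside {-1, ..., -n}, where no denominator vanishes.  The
   coefficients are real, so the polynomial is taken over the reals. *)
definition skyburst :: "nat \<Rightarrow> real \<Rightarrow> real poly" where
  "skyburst n \<omega> =
     (\<Sum>l\<le>n. monom (real (n choose l) * (pochhammer (- \<omega>) l / pochhammer (- real n - \<omega>) l)) (n - l))"

end

theory Submission imports Defs
begin

text \<open>The identity is checked coefficient by coefficient. With \<open>n = Suc m\<close>, both
  sides have leading term \<open>monom 1 (Suc m)\<close>: the shift by z supplies it on the right,
  since the last summand has degree only \<open>m\<close>. Comparing coefficients of z^(m-k) leaves
  the scalar recurrence \<open>skyburst_coeff_rec\<close>. There the three Pochhammer quotients
  differ from one common quotient only by a few linear factors; once these are cleared, what remains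
  is the absorption identity (k+1) C(m,k+1) = (m-k) C(m,k).\<close>

definition skyburst_coeff :: "nat \<Rightarrow> real \<Rightarrow> nat \<Rightarrow> real" where
  "skyburst_coeff n \<omega> l =
     real (n choose l) * (pochhammer (- \<omega>) l / pochhammer (- real n - \<omega>) l)"

lemma skyburst_coeff_0 [simp]: "skyburst_coeff n \<omega> 0 = 1"
  by (simp add: skyburst_coeff_def)

lemma skyburst_coeff_eq_0: "n < l \<Longrightarrow> skyburst_coeff n \<omega> l = 0"
  by (simp add: skyburst_coeff_def binomial_eq_0)

lemma skyburst_eq_sum: "skyburst n \<omega> = (\<Sum>l\<le>n. monom (skyburst_coeff n \<omega> l) (n - l))"
  by (simp add: skyburst_def skyburst_coeff_def)

lemma skyburst_coeff_rec:
  fixes \<omega> :: real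
  assumes "\<omega> > 0" and "k \<le> m"
  shows "skyburst_coeff (Suc m) \<omega> (Suc k) =
    skyburst_coeff m \<omega> (Suc k)
    + \<omega>^2 / ((\<omega> + real m) * (\<omega> + real m + 1)) * skyburst_coeff m (\<omega> - 1) k"
proof -
  \<comment> \<open>The three lower parameters are \<open>a - 1\<close>, \<open>a\<close> and
    \<open>a + 1\<close>, the last because lowering \<omega> by one raises
    \<open>- real m - \<omega>\<close> by one. Likewise the upper parameters are
    \<open>- \<omega>\<close> and \<open>1 - \<omega>\<close>, so every coefficient can be written
    through \<open>P / D\<close>.\<close>
  define a where "a = - real m - \<omega>"
  define P where "P = pochhammer (1 - \<omega>) k"
  define D where "D = pochhammer (a + 1) k"
  define B where "B = real (m choose k)"
  define C where "C = real (m choose Suc k)"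
  have neg: "a < 0" "a - 1 < 0" "a + real k < 0"
    using assms by (auto simp: a_def)
  \<comment> \<open>The factors of \<open>D\<close> are \<open>a + 1 + j\<close> with j < k \<le> m,
    each at most \<open>- \<omega>\<close> and hence negative.\<close>
  have "D \<noteq> 0"
    using assms by (auto simp: D_def a_def pochhammer_eq_0_iff)
  have num: "pochhammer (- \<omega>) (Suc k) = - \<omega> * P"
    by (simp add: pochhammer_rec P_def)
  have den: "pochhammer a (Suc k) = a * D"
    by (simp add: pochhammer_rec D_def)
  \<comment> \<open>Peeling (a)_(k+1) at its top end instead of its bottom end expresses (a)_k
    through \<open>D\<close>, as needed for the denominator starting at
    \<open>a - 1\<close>.\<close>
  have "pochhammer a k * (a + real k) = a * D"
    using den by (simp add: pochhammer_Suc)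
  then have "pochhammer a k = a * D / (a + real k)"
    using neg by (simp add: field_simps)
  then have den': "pochhammer (a - 1) (Suc k) = (a - 1) * (a * D / (a + real k))"
    by (simp add: pochhammer_rec)
  have "Suc k * (m choose Suc k) = (m - k) * (m choose k)"
    by (metis binomial_absorb_comp binomial_absorption mult.commute)
  then have "real (Suc k) * C = real (m - k) * B"
    unfolding B_def C_def by (metis of_nat_mult)
  then have absorb: "(real k + 1) * C = (real m - real k) * B"
    using assms by (simp add: of_nat_diff add.commute)
  have c1: "skyburst_coeff (Suc m) \<omega> (Suc k) =
      (B + C) * (- \<omega> * P / ((a - 1) * (a * D / (a + real k))))"
  proof -
    have "- real (Suc m) - \<omega> = a - 1"
      by (simp add: a_def)
    then show ?thesis
      by (simp only: skyburst_coeff_def num den') (simp add: B_def C_def)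
  qed
  have c2: "skyburst_coeff m \<omega> (Suc k) = C * (- \<omega> * P / (a * D))"
    using num den by (simp add: skyburst_coeff_def C_def a_def)
  have c3: "skyburst_coeff m (\<omega> - 1) k = B * (P / D)"
    by (simp add: skyburst_coeff_def B_def P_def D_def a_def algebra_simps)
  have scale: "(\<omega> + real m) * (\<omega> + real m + 1) = a * (a - 1)"
    by (simp add: a_def algebra_simps)
  \<comment> \<open>This is the recurrence with the common factor
    \<open>- \<omega> * P / (a * (a - 1) * D)\<close> removed. Since
    \<open>a + real m = - \<omega>\<close>, it rearranges to \<open>absorb\<close>.\<close>
  have key: "(B + C) * (a + real k) = C * (a - 1) - \<omega> * B"
    using absorb by (simp add: a_def algebra_simps)
  have "skyburst_coeff (Suc m) \<omega> (Suc k)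
      = - \<omega> * P * ((B + C) * (a + real k)) / (a * (a - 1) * D)"
    unfolding c1 using neg by (simp add: field_simps)
  also have "\<dots> = C * (- \<omega> * P / (a * D)) + \<omega>^2 / (a * (a - 1)) * (B * (P / D))"
    unfolding key using neg \<open>D \<noteq> 0\<close> by (simp add: divide_simps power2_eq_square) algebra
  finally show ?thesis
    unfolding c2 c3 scale .
qed

theorem mainTheorem5:
  fixes \<omega> :: real and n :: nat
  assumes "\<omega> > 0" and "n \<ge> 1"
  shows "skyburst n \<omega> =
           [:0, 1:] * skyburst (n - 1) \<omega>
           + smult (\<omega>^2 / ((\<omega> + real n - 1) * (\<omega> + real n))) (skyburst (n - 1) (\<omega> - 1))"
proof -
  obtain m where n: "n = Suc m"
    using assms(2) by (cases n) auto
  define q where "q = \<omega>^2 / ((\<omega> + real m) * (\<omega> + real m + 1))"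
  have "[:0, 1:] * skyburst m \<omega> = (\<Sum>l\<le>m. monom (skyburst_coeff m \<omega> l) (Suc m - l))"
  proof -
    have "[:0, 1:] = monom (1::real) 1"
      by (simp add: monom_Suc flip: one_pCons)
    then show ?thesis
      by (simp add: skyburst_eq_sum sum_distrib_left mult_monom Suc_diff_le)
  qed
  \<comment> \<open>The added term l = m+1 vanishes because its binomial coefficient does; the range
    now matches that of \<open>skyburst (Suc m) \<omega>\<close>, so splitting off l = 0 aligns the
    two sums.\<close>
  also have "\<dots> = (\<Sum>l\<le>Suc m. monom (skyburst_coeff m \<omega> l) (Suc m - l))"
    by (simp add: skyburst_coeff_eq_0)
  also have "\<dots> = monom 1 (Suc m) + (\<Sum>k\<le>m. monom (skyburst_coeff m \<omega> (Suc k)) (m - k))"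
    by (subst sum.atMost_Suc_shift) simp
  finally have shift: "[:0, 1:] * skyburst m \<omega> = \<dots>" .
  have "skyburst (Suc m) \<omega> =
      monom 1 (Suc m) + (\<Sum>k\<le>m. monom (skyburst_coeff (Suc m) \<omega> (Suc k)) (m - k))"
    unfolding skyburst_eq_sum by (subst sum.atMost_Suc_shift) simp
  also have "(\<Sum>k\<le>m. monom (skyburst_coeff (Suc m) \<omega> (Suc k)) (m - k)) =
      (\<Sum>k\<le>m. monom (skyburst_coeff m \<omega> (Suc k)) (m - k)
             + smult q (monom (skyburst_coeff m (\<omega> - 1) k) (m - k)))"
    using assms(1)
    by (intro sum.cong) (simp_all add: skyburst_coeff_rec q_def add_monom smult_monom)
  also have "\<dots> = (\<Sum>k\<le>m. monom (skyburst_coeff m \<omega> (Suc k)) (m - k))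
      + smult q (skyburst m (\<omega> - 1))"
    \<comment> \<open>Additivity of \<open>smult q\<close> pulls the scalar out of the sum.\<close>
    using sum_comp_morphism[of "smult q" "\<lambda>k. monom (skyburst_coeff m (\<omega> - 1) k) (m - k)" "{..m}"]
    by (simp add: sum.distrib skyburst_eq_sum smult_add_right comp_def del: smult_monom)
  finally have "skyburst (Suc m) \<omega> = [:0, 1:] * skyburst m \<omega> + smult q (skyburst m (\<omega> - 1))"
    by (simp only: shift add.assoc)
  then show ?thesis
    by (simp add: n q_def algebra_simps)
qed

end
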